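(* Let $X,Y$ be real vector spaces and let $F_1,F_2\colon X\rightrightarrows Y$ be set-valued mappings with convex graphs. Suppose that there exists $(x,y_1,y_2)\in X\times Y\times Y$ with $$(x,y_1)\in\mathrm{core}(\mathrm{gph}(F_1))\quad\text{and}\quad(x,y_2)\in\mathrm{core}(\mathrm{gph}(F_2)).$$ Then $$D^*(F_1+F_2)(\bar{x},\bar{y})(g)=D^*F_1(\bar{x},\bar{y}_1)(g)+D^*F_2(\bar{x},\bar{y}_2)(g)$$ for all $(\bar{x},\bar{y})\in\mathrm{gph}(F_1+F_2)$, all $g\in Y'$, and all $(\bar{y}_1,\bar{y}_2)\in S(\bar{x},\bar{y})$, where $$S(\bar{x},\bar{y}):=\{(\bar{y}_1,\bar{y}_2)\in Y\times Y\mid \bar{y}=\bar{y}_1+\bar{y}_2,\ \bar{y}_i\in F_i(\bar{x}),\ i=1,2\}.$$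
   Context: All vector spaces are real and carry no topology. $X'$ denotes the algebraic dual of $X$ (all linear functions $X\to\mathbb{R}$); $(X\times Y)'$ is identified with $X'\times Y'$ via $(f,g)(x,y)=f(x)+g(y)$. For a subset $\Omega$ of a vector space $Z$, $\mathrm{core}(\Omega):=\{x\in\Omega\mid \forall v\in Z\ \exists\delta>0\ \forall t\in\mathbb{R}\text{ with }|t|<\delta:\ x+tv\in\Omega\}$. For a nonempty convex $\Omega\subset Z$ and $\bar{z}\in\Omega$, $N(\bar{z};\Omega):=\{f\in Z'\mid f(z-\bar{z})\le 0\ \forall z\in\Omega\}$. For a set-valued mapping $F\colon X\rightrightarrows Y$ (values are possibly empty subsets of $Y$), $\mathrm{gph}(F):=\{(x,y)\in X\times Y\mid y\in F(x)\}$, and the coderivative of $F$ (with convex graph) at $(\bar{x},\bar{y})\in\mathrm{gph}(F)$ is the set-valued mapping $D^*F(\bar{x},\bar{y})\colon Y'\rightrightarrows X'$, $D^*F(\bar{x},\bar{y})(g):=\{f\in X'\mid (f,-g)\in N((\bar{x},\bar{y});\mathrm{gph}(F))\}$. The sum of mappings is $(F_1+F_2)(x):=\{y_1+y_2\mid y_1\in F_1(x),\ y_2\in F_2(x)\}$. The sum of sets in $X'$ is the Minkowski sum. *)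

theory Defs
  imports "HOL-Analysis.Analysis" "HOL-Library.Function_Algebras" "HOL-Library.Set_Algebras"
begin

text \<open>
  Vector spaces are types of class \<^class>\<open>real_vector\<close>; no topology is involved, so
  \<open>linear\<close> carries no continuity requirement.  A set-valued mapping from \<open>X\<close> to \<open>Y\<close> is
  a function \<open>'x \<Rightarrow> 'y set\<close> (values may be empty).  Addition of functionals is pointwise
  (\<^theory>\<open>HOL-Library.Function_Algebras\<close>), addition of sets is the Minkowski sum
  (\<^theory>\<open>HOL-Library.Set_Algebras\<close>); hence \<open>F1 + F2\<close> for set-valued mappings means
  \<open>x \<mapsto> {y1 + y2 | y1 \<in> F1 x, y2 \<in> F2 x}\<close>.
\<close>

definition algebraic_dual :: "('z::real_vector \<Rightarrow> real) set" where
  "algebraic_dual = {f. linear f}"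

definition core :: "'z::real_vector set \<Rightarrow> 'z set" where
  "core \<Omega> = {x \<in> \<Omega>. \<forall>v. \<exists>\<delta>>0. \<forall>t::real. \<bar>t\<bar> < \<delta> \<longrightarrow> x + t *\<^sub>R v \<in> \<Omega>}"

text \<open>
  Used only for nonempty convex \<open>\<Omega>\<close> and \<open>z0 \<in> \<Omega>\<close>; for other arguments the value has no
  intended meaning.  The same applies to \<open>coderivative\<close> outside convex graphs and their points.
\<close>

definition normal_cone :: "'z::real_vector \<Rightarrow> 'z set \<Rightarrow> ('z \<Rightarrow> real) set" where
  "normal_cone z0 \<Omega> = {f \<in> algebraic_dual. \<forall>z\<in>\<Omega>. f (z - z0) \<le> 0}"

definition gph :: "('x \<Rightarrow> 'y set) \<Rightarrow> ('x \<times> 'y) set" where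
  "gph F = {(x, y). y \<in> F x}"

text \<open>The identification of \<open>X' \<times> Y'\<close> with \<open>(X \<times> Y)'\<close>.\<close>

definition dual_pair :: "('x \<Rightarrow> real) \<Rightarrow> ('y \<Rightarrow> real) \<Rightarrow> 'x \<times> 'y \<Rightarrow> real" where
  "dual_pair f g = (\<lambda>(x, y). f x + g y)"

definition coderivative ::
  "('x::real_vector \<Rightarrow> 'y::real_vector set) \<Rightarrow> 'x \<times> 'y \<Rightarrow> ('y \<Rightarrow> real) \<Rightarrow> ('x \<Rightarrow> real) set"
where
  "coderivative F p g =
     {f \<in> algebraic_dual. dual_pair f (\<lambda>y. - g y) \<in> normal_cone p (gph F)}"

definition sum_decompositions ::
  "('x \<Rightarrow> 'y::real_vector set) \<Rightarrow> ('x \<Rightarrow> 'y set) \<Rightarrow> 'x \<times> 'y \<Rightarrow> ('y \<times> 'y) set"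
where
  "sum_decompositions F1 F2 = (\<lambda>(x, y). {(y1, y2). y = y1 + y2 \<and> y1 \<in> F1 x \<and> y2 \<in> F2 x})"

end

theory Submission
  imports Defs
begin

text \<open>
  A functional \<open>f\<close> in the coderivative of the sum has to be split as \<open>f1 + (f - f1)\<close>.  The
  conditions on \<open>f1\<close> follow from the single inequality
  \<open>f1 (a - b) \<le> g (c1 - y1) + g (c2 - y2) - f (b - x0)\<close> for all \<open>(a, c1)\<close> in \<open>gph F1\<close> and
  \<open>(b, c2)\<close> in \<open>gph F2\<close>, by putting \<open>(b, c2) = (x0, y2)\<close> or \<open>(a, c1) = (x0, y1)\<close>.
  The pairs formed by \<open>a - b\<close> and the right-hand side are a convex set in \<open>X \<times> \<real>\<close>; by the core
  condition the cone it generates projects onto \<open>X\<close>, and by the assumption on \<open>f\<close> it meets the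
  axis \<open>{0} \<times> \<real>\<close> only in nonnegative numbers.  A Hahn--Banach theorem for such cones yields \<open>f1\<close>.
\<close>

section \<open>Hahn-Banach extension for convex cones in X x R\<close>

definition axis_nonneg :: "('a::real_vector \<times> real) set \<Rightarrow> bool" where
  "axis_nonneg K \<longleftrightarrow> (\<forall>r. (0, r) \<in> K \<longrightarrow> 0 \<le> r)"

lemma convex_cone_Union_chain:
  assumes "subset.chain (Collect convex_cone) \<C>" "\<C> \<noteq> {}"
  shows "convex_cone (\<Union>\<C>)"
  unfolding convex_cone_iff
proof (intro conjI ballI allI impI)
  have cc: "convex_cone K" if "K \<in> \<C>" for K
    using assms that by (auto simp: subset_chain_def)
  show "0 \<in> \<Union>\<C>"
    using assms(2) cc convex_cone_contains_0 by blast
  fix x assume "x \<in> \<Union>\<C>"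
  then obtain K where K: "K \<in> \<C>" "x \<in> K" by blast
  show "c *\<^sub>R x \<in> \<Union>\<C>" if "0 \<le> c" for c
    using K cc convex_cone_scaleR that by blast
  fix y assume "y \<in> \<Union>\<C>"
  then obtain L where L: "L \<in> \<C>" "y \<in> L" by blast
  have "K \<subseteq> L \<or> L \<subseteq> K"
    using assms K L by (auto simp: subset_chain_def)
  then show "x + y \<in> \<Union>\<C>"
    using K L cc convex_cone_add by (metis UnionI subsetD)
qed

text \<open>Zorn's lemma applies because both properties pass to unions of chains. When the cone
  projects onto the whole space, the maximal one turns out to be the epigraph of the linear
  functional sought.\<close>

lemma axis_nonneg_maximal_cone:
  assumes "convex_cone K0" "axis_nonneg K0"
  obtains K where "K0 \<subseteq> K" "convex_cone K" "axis_nonneg K"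
    "\<And>L. \<lbrakk>K \<subseteq> L; convex_cone L; axis_nonneg L\<rbrakk> \<Longrightarrow> L = K"
proof -
  define A where "A = {K. K0 \<subseteq> K \<and> convex_cone K \<and> axis_nonneg K}"
  have "\<exists>M\<in>A. \<forall>X\<in>A. M \<subseteq> X \<longrightarrow> X = M"
  proof (rule subset_Zorn_nonempty)
    show "A \<noteq> {}" using assms by (auto simp: A_def)
    fix \<C> assume ne: "\<C> \<noteq> {}" and ch: "subset.chain A \<C>"
    have "\<C> \<subseteq> A"
      using ch by (simp add: subset_chain_def)
    then have "K0 \<subseteq> \<Union>\<C>" "axis_nonneg (\<Union>\<C>)"
      using ne by (auto simp: A_def axis_nonneg_def)
    moreover have "subset.chain (Collect convex_cone) \<C>"
      using ch by (auto simp: subset_chain_def A_def)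
    then have "convex_cone (\<Union>\<C>)"
      using ne by (rule convex_cone_Union_chain)
    ultimately show "\<Union>\<C> \<in> A"
      by (simp add: A_def)
  qed
  then obtain K where "K \<in> A" and max: "\<And>L. L \<in> A \<Longrightarrow> K \<subseteq> L \<Longrightarrow> L = K"
    by blast
  show ?thesis
  proof (rule that)
    show "K0 \<subseteq> K" "convex_cone K" "axis_nonneg K"
      using \<open>K \<in> A\<close> by (simp_all add: A_def)
    show "L = K" if "K \<subseteq> L" "convex_cone L" "axis_nonneg L" for L
      using that \<open>K0 \<subseteq> K\<close> by (intro max) (auto simp: A_def)
  qed
qed

text \<open>Adjoining the ray through \<open>(- w, - c)\<close> keeps the axis condition: if
  \<open>(0, r) = p + t *\<^sub>R (- w, - c)\<close> with \<open>p\<close> in \<open>K\<close> and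
  \<open>t > 0\<close>, then \<open>p\<close> divided by \<open>t\<close> is
  \<open>(w, r / t + c)\<close>, so \<open>lower\<close> gives \<open>0 \<le> r / t\<close>.
  Maximality then puts the ray into \<open>K\<close>.\<close>

lemma maximal_cone_contains_opposite:
  assumes K: "convex_cone K" "axis_nonneg K"
    and max: "\<And>L. \<lbrakk>K \<subseteq> L; convex_cone L; axis_nonneg L\<rbrakk> \<Longrightarrow> L = K"
    and lower: "\<And>r. (w, r) \<in> K \<Longrightarrow> c \<le> r"
  shows "(- w, - c) \<in> K"
proof -
  define L where "L = {p + t *\<^sub>R (- w, - c) | p t. p \<in> K \<and> 0 \<le> t}"
  have LI: "p + t *\<^sub>R (- w, - c) \<in> L" if "p \<in> K" "0 \<le> t" for p t
    using that unfolding L_def by blast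
  have "K \<subseteq> L"
    using LI[where t = 0] by auto
  moreover have "convex_cone L"
    unfolding convex_cone_iff
  proof (intro conjI ballI allI impI)
    show "0 \<in> L"
      using \<open>K \<subseteq> L\<close> convex_cone_contains_0[OF K(1)] by blast
    fix x assume "x \<in> L"
    then obtain p t where x: "x = p + t *\<^sub>R (- w, - c)" "p \<in> K" "0 \<le> t"
      unfolding L_def by blast
    show "a *\<^sub>R x \<in> L" if "0 \<le> a" for a
      using LI[of "a *\<^sub>R p" "a * t"] x that convex_cone_scaleR[OF K(1)]
      by (simp add: scaleR_add_right del: scaleR_Pair)
    fix y assume "y \<in> L"
    then obtain q s where y: "y = q + s *\<^sub>R (- w, - c)" "q \<in> K" "0 \<le> s"
      unfolding L_def by blast
    have sum: "x + y = (p + q) + (t + s) *\<^sub>R (- w, - c)"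
      by (simp add: x y scaleR_add_left del: scaleR_Pair)
    show "x + y \<in> L"
      unfolding sum using x y convex_cone_add[OF K(1)] by (intro LI) auto
  qed
  moreover have "axis_nonneg L"
    unfolding axis_nonneg_def
  proof (intro allI impI)
    fix r assume "(0, r) \<in> L"
    then obtain p t where p: "(0, r) = p + t *\<^sub>R (- w, - c)" "p \<in> K" "0 \<le> t"
      unfolding L_def by blast
    then have p_eq: "p = (t *\<^sub>R w, r + t * c)"
      by (cases p) (simp add: algebra_simps)
    show "0 \<le> r"
    proof (cases "t = 0")
      case True
      then show ?thesis
        using p(2) p_eq K(2) by (simp add: axis_nonneg_def)
    next
      case False
      then have "0 < t" using p(3) by simp
      then have "(w, (r + t * c) / t) \<in> K"
        using convex_cone_scaleR[OF K(1) _ p(2), of "1 / t"] by (simp add: p_eq)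
      from lower[OF this] show ?thesis
        using \<open>0 < t\<close> by (simp add: field_simps)
    qed
  qed
  ultimately have "L = K" by (rule max)
  then show ?thesis
    using LI[of 0 1] convex_cone_contains_0[OF K(1)] by simp
qed

text \<open>Let \<open>K\<close> be a maximal extension of \<open>K0\<close>. Over each
  \<open>v\<close> the infimum of the fibre of \<open>K\<close> is attained, and its negative lies
  in the fibre over \<open>- v\<close>. These infima are the values of \<open>f\<close>; both
  one-sided estimates for linearity come from closure of \<open>K\<close> under sums and nonnegative
  multiples.\<close>

theorem Hahn_Banach_convex_cone:
  fixes K0 :: "('a::real_vector \<times> real) set"
  assumes "convex_cone K0" and "axis_nonneg K0" and surj: "fst ` K0 = UNIV"
  obtains f where "linear f" "\<And>v r. (v, r) \<in> K0 \<Longrightarrow> f v \<le> r"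
proof -
  obtain K where sub: "K0 \<subseteq> K" and K: "convex_cone K" "axis_nonneg K"
    and max: "\<And>L. \<lbrakk>K \<subseteq> L; convex_cone L; axis_nonneg L\<rbrakk> \<Longrightarrow> L = K"
    using axis_nonneg_maximal_cone[OF assms(1,2)] by blast
  have opposite: "(- w, - c) \<in> K" if "\<And>r. (w, r) \<in> K \<Longrightarrow> c \<le> r" for w c
    using K max that by (rule maximal_cone_contains_opposite)
  have le: "- s \<le> r" if "(v, r) \<in> K" "(- v, s) \<in> K" for v r s
    using convex_cone_add[OF K(1) that] K(2) by (force simp: axis_nonneg_def)
  have total: "\<exists>r. (v, r) \<in> K" for v
  proof -
    have "v \<in> fst ` K0" using surj by simp
    then show ?thesis using sub by auto
  qed
  have "\<exists>c. (v, c) \<in> K \<and> (- v, - c) \<in> K" for v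
  proof -
    \<comment> \<open>The infimum is a genuine one: \<open>r0\<close> makes the fibre nonempty and
      \<open>- s0\<close> bounds it below.\<close>
    define c where "c = Inf {r. (v, r) \<in> K}"
    obtain r0 s0 where r0: "(v, r0) \<in> K" and s0: "(- v, s0) \<in> K"
      using total by blast
    have "c \<le> r" if "(v, r) \<in> K" for r
      unfolding c_def using that le[OF _ s0] by (intro cInf_lower bdd_belowI[of _ "- s0"]) auto
    then have 1: "(- v, - c) \<in> K"
      by (rule opposite)
    have "- s \<le> c" if "(- v, s) \<in> K" for s
      unfolding c_def using r0 le[OF _ that] by (intro cInf_greatest) auto
    then have "- c \<le> s" if "(- v, s) \<in> K" for s
      using that by force
    \<comment> \<open>The same principle at \<open>- v\<close> with the bound \<open>- c\<close>
      shows that the infimum \<open>c\<close> is attained.\<close>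
    then have "(- (- v), - (- c)) \<in> K"
      by (rule opposite)
    with 1 show ?thesis by auto
  qed
  then obtain f where f: "\<And>v. (v, f v) \<in> K" "\<And>v. (- v, - f v) \<in> K"
    by metis
  have f_le: "f v \<le> r" if "(v, r) \<in> K" for v r
    using le[OF that f(2)] by simp
  have f_ge: "s \<le> f v" if "(- v, - s) \<in> K" for v s
    using le[OF f(1) that] by simp
  have "linear f"
  proof (rule linearI)
    fix v w
    show "f (v + w) = f v + f w"
    proof (rule antisym)
      show "f (v + w) \<le> f v + f w"
        using convex_cone_add[OF K(1) f(1)[of v] f(1)[of w]] by (intro f_le) simp
      show "f v + f w \<le> f (v + w)"
        using convex_cone_add[OF K(1) f(2)[of v] f(2)[of w]]
        by (intro f_ge) (simp add: algebra_simps)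
    qed
  next
    fix a v
    show "f (a *\<^sub>R v) = a *\<^sub>R f v"
    proof (cases "0 \<le> a")
      case True
      show ?thesis
        using convex_cone_scaleR[OF K(1) True f(1)[of v]] convex_cone_scaleR[OF K(1) True f(2)[of v]]
        by (intro antisym f_le f_ge) auto
    next
      case False
      \<comment> \<open>Scaling by \<open>- a\<close> swaps the roles of the two points:
        \<open>(v, f v)\<close> now yields the lower bound for \<open>f (a *\<^sub>R v)\<close> and
        \<open>(- v, - f v)\<close> the upper one.\<close>
      then have a: "0 \<le> - a" by simp
      show ?thesis
        using convex_cone_scaleR[OF K(1) a f(1)[of v]] convex_cone_scaleR[OF K(1) a f(2)[of v]]
        by (intro antisym f_le f_ge) auto
    qed
  qed
  then show ?thesis
    using that f_le sub by blast
qed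

lemma axis_nonneg_conic_hull:
  assumes "axis_nonneg C"
  shows "axis_nonneg (conic hull C)"
  unfolding axis_nonneg_def
proof (intro allI impI)
  fix r assume "(0, r) \<in> conic hull C"
  then obtain s v q where *: "0 \<le> s" "(v, q) \<in> C" "0 = s *\<^sub>R v" "r = s * q"
    by (auto simp: conic_hull_explicit)
  then show "0 \<le> r"
    using assms by (cases "s = 0") (auto simp: axis_nonneg_def)
qed

text \<open>Passing to the conic hull reduces this to cones. By \<open>abs\<close>, some positive
  multiple of every vector lies in the projection of \<open>C\<close>, so the hull projects onto the
  whole space.\<close>

corollary Hahn_Banach_convex:
  fixes C :: "('a::real_vector \<times> real) set"
  assumes "convex C" and "axis_nonneg C" and abs: "\<And>v. \<exists>t>0. t *\<^sub>R v \<in> fst ` C"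
  obtains f where "linear f" "\<And>v r. (v, r) \<in> C \<Longrightarrow> f v \<le> r"
proof (rule Hahn_Banach_convex_cone)
  show "convex_cone (conic hull C)"
    using assms(1) abs by (auto simp: convex_cone_def convex_conic_hull conic_conic_hull conic_hull_eq_empty)
  show "axis_nonneg (conic hull C)"
    using assms(2) by (rule axis_nonneg_conic_hull)
  show "fst ` (conic hull C) = UNIV"
  proof (intro equalityI subsetI UNIV_I)
    fix v :: 'a
    obtain t p where t: "0 < t" "t *\<^sub>R v = fst p" "p \<in> C"
      using abs[of v] by blast
    then have "(1 / t) *\<^sub>R p \<in> conic hull C"
      using conicD[OF conic_conic_hull hull_inc[OF t(3)], of "1 / t"] by simp
    moreover have "v = fst ((1 / t) *\<^sub>R p)"
      using t(1) by (simp flip: t(2))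
    ultimately show "v \<in> fst ` (conic hull C)" by (rule rev_image_eqI)
  qed
qed (use that hull_subset in fast)

section \<open>The coderivative sum rule\<close>

lemma coderivative_iff:
  assumes "linear g"
  shows "f \<in> coderivative F (x0, y0) g \<longleftrightarrow>
    linear f \<and> (\<forall>x y. y \<in> F x \<longrightarrow> f (x - x0) \<le> g (y - y0))"
proof -
  have "linear (dual_pair f (\<lambda>y. - g y))" if "linear f"
    unfolding dual_pair_def
    by (intro linearI) (auto simp: linear_add[OF that] linear_add[OF assms]
        linear_scale[OF that] linear_scale[OF assms] algebra_simps)
  then show ?thesis
    by (auto simp: coderivative_def normal_cone_def algebraic_dual_def gph_def dual_pair_def)
qed

lemma coderivative_sum_subset:
  assumes g: "linear g"
  shows "coderivative F1 (x0, y1) g + coderivative F2 (x0, y2) g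
    \<subseteq> coderivative (F1 + F2) (x0, y1 + y2) g"
proof
  fix f assume "f \<in> coderivative F1 (x0, y1) g + coderivative F2 (x0, y2) g"
  then obtain f1 f2 where f: "f = f1 + f2"
    and f1: "linear f1" "\<And>x y. y \<in> F1 x \<Longrightarrow> f1 (x - x0) \<le> g (y - y1)"
    and f2: "linear f2" "\<And>x y. y \<in> F2 x \<Longrightarrow> f2 (x - x0) \<le> g (y - y2)"
    by (auto simp: set_plus_def coderivative_iff[OF g])
  have "linear f"
    using f1(1) f2(1) unfolding f plus_fun_def by (rule linear_compose_add)
  moreover have "f (x - x0) \<le> g (y - (y1 + y2))" if y: "y \<in> (F1 + F2) x" for x y
  proof -
    obtain c1 c2 where c: "y = c1 + c2" "c1 \<in> F1 x" "c2 \<in> F2 x"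
      using y by (auto simp: set_plus_def)
    have "g (y - (y1 + y2)) = g (c1 - y1) + g (c2 - y2)"
      by (simp add: c linear_add[OF g] linear_diff[OF g])
    then show ?thesis
      using f1(2)[OF c(2)] f2(2)[OF c(3)] by (simp add: f)
  qed
  ultimately show "f \<in> coderivative (F1 + F2) (x0, y1 + y2) g"
    by (simp add: coderivative_iff[OF g])
qed

lemma coderivative_sum_supset:
  fixes F1 F2 :: "'x::real_vector \<Rightarrow> 'y::real_vector set"
  assumes cvx: "convex (gph F1)" "convex (gph F2)"
    and core1: "(x, z1) \<in> core (gph F1)" and core2: "(x, z2) \<in> core (gph F2)"
    and g: "linear g" and y1: "y1 \<in> F1 x0" and y2: "y2 \<in> F2 x0"
  shows "coderivative (F1 + F2) (x0, y1 + y2) g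
    \<subseteq> coderivative F1 (x0, y1) g + coderivative F2 (x0, y2) g"
proof
  fix f assume "f \<in> coderivative (F1 + F2) (x0, y1 + y2) g"
  then have f: "linear f"
    and f_le: "\<And>u y. y \<in> (F1 + F2) u \<Longrightarrow> f (u - x0) \<le> g (y - (y1 + y2))"
    by (simp_all add: coderivative_iff[OF g])
  have f_le': "f (u - x0) \<le> g (c1 - y1) + g (c2 - y2)" if "c1 \<in> F1 u" "c2 \<in> F2 u" for u c1 c2
    using f_le[of "c1 + c2" u] that
    by (simp add: set_plus_intro linear_diff[OF g] linear_add[OF g])
  \<comment> \<open>Splitting off the constant \<open>f x0 - g y1 - g y2\<close> leaves a linear
    map, so \<open>C\<close> is a translate of a linear image of the product of the graphs and hence
    convex.\<close>
  define T where "T = (\<lambda>((a, c1), (b, c2)). (a - b :: 'x, g c1 + g c2 - f b))"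
  define C where "C = (+) (0, f x0 - g y1 - g y2) ` T ` (gph F1 \<times> gph F2)"
  have T: "(0, f x0 - g y1 - g y2) + T ((a, c1), (b, c2))
      = (a - b, g (c1 - y1) + g (c2 - y2) - f (b - x0))" for a b c1 c2
    by (simp add: T_def linear_diff[OF f] linear_diff[OF g])
  have CI: "(a - b, g (c1 - y1) + g (c2 - y2) - f (b - x0)) \<in> C"
    if "c1 \<in> F1 a" "c2 \<in> F2 b" for a b c1 c2
    unfolding T[symmetric] C_def using that by (intro imageI) (simp add: gph_def)
  have "linear T"
    unfolding T_def
    by (intro linearI) (auto simp: linear_add[OF f] linear_add[OF g] linear_scale[OF f]
        linear_scale[OF g] algebra_simps)
  then have "convex C"
    unfolding C_def using cvx by (intro convex_translation convex_linear_image convex_Times)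
  \<comment> \<open>A zero first component forces \<open>a = b\<close>, so both graph points lie
    over one argument and \<open>f_le'\<close> applies.\<close>
  moreover have "axis_nonneg C"
    unfolding axis_nonneg_def
  proof (intro allI impI)
    fix r assume "(0, r) \<in> C"
    then obtain a c1 b c2 where c: "c1 \<in> F1 a" "c2 \<in> F2 b"
      and "(0, r) = (0, f x0 - g y1 - g y2) + T ((a, c1), (b, c2))"
      unfolding C_def gph_def by blast
    then have "a = b" "r = g (c1 - y1) + g (c2 - y2) - f (b - x0)"
      unfolding T by auto
    with c f_le' show "0 \<le> r" by simp
  qed
  \<comment> \<open>Move \<open>(x, z1)\<close> inside the first graph in the direction
    \<open>(v, 0)\<close> and keep \<open>(x, z2)\<close> fixed in the second; the first arguments
    then differ by \<open>(\<delta> / 2) *\<^sub>R v\<close>.\<close>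
  moreover have "\<exists>t>0. t *\<^sub>R v \<in> fst ` C" for v
  proof -
    obtain \<delta> where "\<delta> > 0" "\<And>t. \<bar>t\<bar> < \<delta> \<Longrightarrow> (x, z1) + t *\<^sub>R (v, 0) \<in> gph F1"
      using core1 unfolding core_def by blast
    from this(1) this(2)[of "\<delta> / 2"] have "z1 \<in> F1 (x + (\<delta> / 2) *\<^sub>R v)"
      by (simp add: gph_def)
    moreover have "z2 \<in> F2 x"
      using core2 by (simp add: core_def gph_def)
    ultimately show ?thesis
      using CI[of z1 "x + (\<delta> / 2) *\<^sub>R v" z2 x] \<open>\<delta> > 0\<close>
      by (intro exI[of _ "\<delta> / 2"]) (auto intro: rev_image_eqI)
  qed
  ultimately obtain f1 where f1: "linear f1" and f1_le: "\<And>v r. (v, r) \<in> C \<Longrightarrow> f1 v \<le> r"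
    using Hahn_Banach_convex by blast
  have "f1 \<in> coderivative F1 (x0, y1) g"
    using f1 f1_le[OF CI[OF _ y2]] by (auto simp: coderivative_iff[OF g] linear_0 f g)
  moreover have "f - f1 \<in> coderivative F2 (x0, y2) g"
  proof -
    have "linear (f - f1)"
      using f f1 unfolding fun_diff_def by (rule linear_compose_sub)
    moreover have "f (u - x0) - f1 (u - x0) \<le> g (c - y2)" if "c \<in> F2 u" for u c
      using f1_le[OF CI[OF y1 that]] by (simp add: linear_diff[OF f1] linear_0[OF g])
    ultimately show ?thesis
      by (simp add: coderivative_iff[OF g])
  qed
  moreover have "f = f1 + (f - f1)" by simp
  ultimately show "f \<in> coderivative F1 (x0, y1) g + coderivative F2 (x0, y2) g"
    by (metis set_plus_intro)
qed

theorem theorem6p1: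
  fixes F1 F2 :: "'x::real_vector \<Rightarrow> 'y::real_vector set"
  assumes "convex (gph F1)" and "convex (gph F2)"
    and "\<exists>x y1 y2. (x, y1) \<in> core (gph F1) \<and> (x, y2) \<in> core (gph F2)"
  shows "\<forall>x0 y0. (x0, y0) \<in> gph (F1 + F2) \<longrightarrow>
           (\<forall>g \<in> algebraic_dual. \<forall>(y1, y2) \<in> sum_decompositions F1 F2 (x0, y0).
              coderivative (F1 + F2) (x0, y0) g
                = coderivative F1 (x0, y1) g + coderivative F2 (x0, y2) g)"
proof -
  obtain x z1 z2 where core: "(x, z1) \<in> core (gph F1)" "(x, z2) \<in> core (gph F2)"
    using assms(3) by blast
  have "coderivative (F1 + F2) (x0, y1 + y2) g
      = coderivative F1 (x0, y1) g + coderivative F2 (x0, y2) g"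
    if "linear g" "y1 \<in> F1 x0" "y2 \<in> F2 x0" for x0 y1 y2 g
    using coderivative_sum_supset[OF assms(1,2) core that] coderivative_sum_subset[OF that(1)]
    by (rule equalityI)
  then show ?thesis
    by (auto simp: algebraic_dual_def sum_decompositions_def)
qed

end
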